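(* Let $P$ be Thompson's quandle, with generators $p_0,p_1,p_2,\dots$, and let $\epsilon\colon P\to P$ be the quandle endomorphism with $\epsilon(p_n)=p_{n+1}$ for all $n\geqslant 0$. If $Q$ is a quandle together with a quandle endomorphism $\delta\colon Q\to Q$ and an element $q_0\in Q$ such that $\delta^2(q)=q_0\rhd\delta(q)$ for all $q\in Q$, then there is a unique morphism $f\colon P\to Q$ of quandles such that $f(p_0)=q_0$ and $\delta f=f\epsilon$.
   Context: A quandle is a set $Q$ with a binary operation $\rhd$ such that for every $x\in Q$ the left multiplication $y\mapsto x\rhd y$ is bijective, $x\rhd(y\rhd z)=(x\rhd y)\rhd(x\rhd z)$ for all $x,y,z$, and $x\rhd x=x$ for all $x$. Morphisms of quandles are maps preserving $\rhd$. Quandles form an algebraic theory, so quandles may be defined by generators and relations. Thompson's quandle $P$ is the quandle with generators $p_0,p_1,p_2,\dots$ and relations $p_j\rhd p_k=p_{k+1}$ for all $0\leqslant j<k$. The assignment $p_n\mapsto p_{n+1}$ respects these relations and so defines an endomorphism $\epsilon$ of $P$. *)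

theory Defs
  imports Main
begin

locale quandle =
  fixes carrier :: "'a set"
    and rhd :: "'a \<Rightarrow> 'a \<Rightarrow> 'a"  (infixr \<open>\<rhd>\<close> 70)
  assumes left_bij: "x \<in> carrier \<Longrightarrow> bij_betw (\<lambda>y. x \<rhd> y) carrier carrier"
    and left_distrib: "\<lbrakk>x \<in> carrier; y \<in> carrier; z \<in> carrier\<rbrakk>
      \<Longrightarrow> x \<rhd> (y \<rhd> z) = (x \<rhd> y) \<rhd> (x \<rhd> z)"
    and idem: "x \<in> carrier \<Longrightarrow> x \<rhd> x = x"

definition quandle_hom ::
  "'a set \<Rightarrow> ('a \<Rightarrow> 'a \<Rightarrow> 'a) \<Rightarrow> 'b set \<Rightarrow> ('b \<Rightarrow> 'b \<Rightarrow> 'b) \<Rightarrow> ('a \<Rightarrow> 'b) \<Rightarrow> bool" where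
  "quandle_hom A opA B opB f \<longleftrightarrow>
     (\<forall>x\<in>A. f x \<in> B) \<and> (\<forall>x\<in>A. \<forall>y\<in>A. f (opA x y) = opB (f x) (f y))"

text \<open>
  Quandles as an algebraic theory: bijectivity of the left multiplications is expressed
  by a second operation, left division, which is inverse to \<open>\<rhd>\<close> in its second argument.
  Terms are built from both operations, and \<open>qcong R\<close> is the least congruence on terms
  containing the quandle equations and the relations \<open>R\<close>. The quandle presented by
  generators \<open>'g\<close> and relations \<open>R\<close> is the quotient of the terms by \<open>qcong R\<close>.
\<close>

datatype 'g qterm = Gen 'g | Op "'g qterm" "'g qterm" | Ldiv "'g qterm" "'g qterm"

inductive qcong :: "('g qterm \<times> 'g qterm) set \<Rightarrow> 'g qterm \<Rightarrow> 'g qterm \<Rightarrow> bool"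
  for R where
  refl: "qcong R s s"
| sym: "qcong R s t \<Longrightarrow> qcong R t s"
| trans: "qcong R s t \<Longrightarrow> qcong R t u \<Longrightarrow> qcong R s u"
| cong_Op: "qcong R s s' \<Longrightarrow> qcong R t t' \<Longrightarrow> qcong R (Op s t) (Op s' t')"
| cong_Ldiv: "qcong R s s' \<Longrightarrow> qcong R t t' \<Longrightarrow> qcong R (Ldiv s t) (Ldiv s' t')"
| Op_Ldiv: "qcong R (Op s (Ldiv s t)) t"
| Ldiv_Op: "qcong R (Ldiv s (Op s t)) t"
| distrib: "qcong R (Op s (Op t u)) (Op (Op s t) (Op s u))"
| idem: "qcong R (Op s s) s"
| rel: "(s, t) \<in> R \<Longrightarrow> qcong R s t"

lemma equivp_qcong: "equivp (qcong R)"
  by (intro equivpI reflpI sympI transpI) (blast intro: qcong.intros)+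

definition thompson_rels :: "(nat qterm \<times> nat qterm) set" where
  "thompson_rels = {(Op (Gen j) (Gen k), Gen (k + 1)) | j k. j < k}"

quotient_type thompson = "nat qterm" / "qcong thompson_rels"
  by (rule equivp_qcong)

lift_definition thompson_gen :: "nat \<Rightarrow> thompson" is Gen .

lift_definition thompson_op :: "thompson \<Rightarrow> thompson \<Rightarrow> thompson" is Op
  by (rule qcong.cong_Op)

lift_definition thompson_ldiv :: "thompson \<Rightarrow> thompson \<Rightarrow> thompson" is Ldiv
  by (rule qcong.cong_Ldiv)

lemma qcong_shift:
  assumes "qcong thompson_rels s t"
  shows "qcong thompson_rels (map_qterm Suc s) (map_qterm Suc t)"
  using assms
proof induction
  case (rel s t)
  then show ?case
    by (force simp: thompson_rels_def intro: qcong.rel)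
qed (auto intro: qcong.intros)

lift_definition thompson_eps :: "thompson \<Rightarrow> thompson" is "map_qterm Suc"
  by (rule qcong_shift)

lemma quandle_thompson: "quandle UNIV thompson_op"
proof
  fix x y z :: thompson
  have *: "thompson_op x (thompson_ldiv x y) = y" "thompson_ldiv x (thompson_op x y) = y" for y
    by (transfer, rule qcong.Op_Ldiv) (transfer, rule qcong.Ldiv_Op)
  then show "bij_betw (thompson_op x) UNIV UNIV"
    by (intro bij_betw_byWitness[where f' = "thompson_ldiv x"]) auto
  show "thompson_op x (thompson_op y z) = thompson_op (thompson_op x y) (thompson_op x z)"
    by transfer (rule qcong.distrib)
  show "thompson_op x x = x"
    by transfer (rule qcong.idem)
qed

lemma thompson_gen_rel:
  "j < k \<Longrightarrow> thompson_op (thompson_gen j) (thompson_gen k) = thompson_gen (k + 1)"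
  by transfer (auto simp: thompson_rels_def intro: qcong.rel)

lemma thompson_eps_gen: "thompson_eps (thompson_gen n) = thompson_gen (n + 1)"
  by transfer (simp add: qcong.refl)

lemma thompson_eps_hom: "quandle_hom UNIV thompson_op UNIV thompson_op thompson_eps"
  unfolding quandle_hom_def by (simp, transfer) (simp add: qcong.refl)

end

theory Submission
  imports Defs
begin

text \<open>
  Morphisms out of Thompson's quandle are the same as sequences \<open>q\<^sub>0, q\<^sub>1, \<dots>\<close> satisfying
  \<open>q\<^sub>j \<rhd> q\<^sub>k = q\<^sub>k\<^sub>+\<^sub>1\<close> for \<open>j < k\<close>: existence is \<open>thompson_hom_exists\<close>, obtained by evaluating
  terms, and uniqueness is \<open>thompson_hom_eqI\<close>. The intertwining condition forces
  \<open>q\<^sub>n = \<delta>\<^sup>n(q\<^sub>0)\<close>, so at most one morphism is possible. Conversely these iterates satisfy the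
  relations: the hypothesis on \<open>\<delta>\<close> is the case \<open>j = 0\<close>, and applying the endomorphism \<open>\<delta>\<^sup>j\<close>
  to that case gives the rest (\<open>iterates_thompson_rels\<close>). For the resulting morphism \<open>f\<close>, the
  morphisms \<open>\<delta> \<circ> f\<close> and \<open>f \<circ> \<epsilon>\<close> agree on generators, and therefore everywhere.
\<close>

primrec qeval :: "'a set \<Rightarrow> ('a \<Rightarrow> 'a \<Rightarrow> 'a) \<Rightarrow> ('g \<Rightarrow> 'a) \<Rightarrow> 'g qterm \<Rightarrow> 'a" where
  "qeval A rhd g (Gen i) = g i"
| "qeval A rhd g (Op s t) = rhd (qeval A rhd g s) (qeval A rhd g t)"
| "qeval A rhd g (Ldiv s t) = inv_into A (rhd (qeval A rhd g s)) (qeval A rhd g t)"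

context quandle
begin

lemma rhd_closed: "x \<in> carrier \<Longrightarrow> y \<in> carrier \<Longrightarrow> x \<rhd> y \<in> carrier"
  using left_bij bij_betwE by blast

lemma ldiv_closed: "x \<in> carrier \<Longrightarrow> y \<in> carrier \<Longrightarrow> inv_into carrier ((\<rhd>) x) y \<in> carrier"
  by (rule inv_into_into) (use left_bij[of x] in \<open>simp add: bij_betw_def\<close>)

lemma qeval_closed: "(\<And>i. g i \<in> carrier) \<Longrightarrow> qeval carrier (\<rhd>) g t \<in> carrier"
  by (induction t) (simp_all add: rhd_closed ldiv_closed)

text \<open>
  Equality of values is itself a congruence containing the quandle equations, so it contains
  the least congruence \<open>qcong R\<close> once it contains the relations \<open>R\<close>.
\<close>
lemma qeval_qcong:
  assumes g: "\<And>i. g i \<in> carrier"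
    and R: "\<And>s t. (s, t) \<in> R \<Longrightarrow> qeval carrier (\<rhd>) g s = qeval carrier (\<rhd>) g t"
    and st: "qcong R s t"
  shows "qeval carrier (\<rhd>) g s = qeval carrier (\<rhd>) g t"
  using st
proof induction
  case (Op_Ldiv s t)
  show ?case
    using bij_betw_inv_into_right[OF left_bij] qeval_closed[of g, OF g] by simp
next
  case (Ldiv_Op s t)
  show ?case
    using bij_betw_inv_into_left[OF left_bij] qeval_closed[of g, OF g] by simp
qed (simp_all add: R left_distrib idem qeval_closed[of g, OF g])

end

lemma thompson_induct [case_names gen op ldiv]:
  assumes "\<And>n. P (thompson_gen n)"
    and "\<And>x y. P x \<Longrightarrow> P y \<Longrightarrow> P (thompson_op x y)"
    and "\<And>x y. P x \<Longrightarrow> P y \<Longrightarrow> P (thompson_ldiv x y)"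
  shows "P x"
proof -
  have "P (abs_thompson t)" for t
    by (induction t)
      (simp_all add: thompson_gen.abs_eq[symmetric] thompson_op.abs_eq[symmetric]
        thompson_ldiv.abs_eq[symmetric] assms)
  from this[of "rep_thompson x"] show ?thesis
    by (simp add: Quotient3_abs_rep[OF Quotient3_thompson])
qed

lemma thompson_op_ldiv: "thompson_op x (thompson_ldiv x y) = y"
  by transfer (rule qcong.Op_Ldiv)

text \<open>
  Morphisms are only required to preserve \<open>\<rhd>\<close>; they agree on left quotients because left
  multiplications in the codomain are injective.
\<close>
lemma thompson_hom_eqI:
  assumes "quandle A rhd"
    and f: "quandle_hom UNIV thompson_op A rhd f"
    and h: "quandle_hom UNIV thompson_op A rhd h"
    and gen: "\<And>n. f (thompson_gen n) = h (thompson_gen n)"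
  shows "f = h"
proof
  interpret quandle A rhd by fact
  fix x
  show "f x = h x"
  proof (induction x rule: thompson_induct)
    case (ldiv x y)
    have "rhd (f x) (f (thompson_ldiv x y)) = f y"
      using f by (metis UNIV_I quandle_hom_def thompson_op_ldiv)
    also have "\<dots> = rhd (f x) (h (thompson_ldiv x y))"
      using h ldiv by (metis UNIV_I quandle_hom_def thompson_op_ldiv)
    finally have eq: "rhd (f x) (f (thompson_ldiv x y)) = rhd (f x) (h (thompson_ldiv x y))" .
    have "inj_on (rhd (f x)) A"
      using left_bij f by (simp add: bij_betw_def quandle_hom_def)
    then show ?case
      using eq f h by (auto simp: quandle_hom_def dest: inj_onD)
  qed (use f h gen in \<open>auto simp: quandle_hom_def\<close>)
qed

text \<open>
  The value of any representing term serves as the image of an element: \<open>qeval_qcong\<close> makes it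
  independent of the choice, and compatibility with \<open>\<rhd>\<close> follows by computing the image of a
  product with the product of the two representatives.
\<close>
lemma thompson_hom_exists:
  fixes g :: "nat \<Rightarrow> 'a"
  assumes "quandle A rhd"
    and g: "\<And>n. g n \<in> A"
    and rels: "\<And>j k. j < k \<Longrightarrow> rhd (g j) (g k) = g (Suc k)"
  shows "\<exists>f. quandle_hom UNIV thompson_op A rhd f \<and> (\<forall>n. f (thompson_gen n) = g n)"
proof -
  interpret quandle A rhd by fact
  define f where "f x = qeval A rhd g (rep_thompson x)" for x
  have abs: "f (abs_thompson t) = qeval A rhd g t" for t
  proof -
    have "qcong thompson_rels (rep_thompson (abs_thompson t)) t"
      by (rule rep_abs_rsp_left[OF Quotient3_thompson refl])
    then show ?thesis
      unfolding f_def by (rule qeval_qcong[OF g, rotated]) (auto simp: thompson_rels_def rels)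
  qed
  have hom: "f (thompson_op x y) = rhd (f x) (f y)" for x y
    using abs[of "Op (rep_thompson x) (rep_thompson y)"]
    by (simp add: thompson_op.abs_eq[symmetric] Quotient3_abs_rep[OF Quotient3_thompson] f_def)
  have closed: "f x \<in> A" for x
    unfolding f_def by (rule qeval_closed[OF g])
  show ?thesis
  proof (intro exI[of _ f] conjI allI)
    show "quandle_hom UNIV thompson_op A rhd f"
      by (simp add: quandle_hom_def hom closed)
    show "f (thompson_gen n) = g n" for n
      by (simp add: thompson_gen.abs_eq abs)
  qed
qed

lemma quandle_hom_comp:
  "quandle_hom A opA B opB f \<Longrightarrow> quandle_hom B opB C opC h \<Longrightarrow> quandle_hom A opA C opC (h \<circ> f)"
  by (simp add: quandle_hom_def)

lemma iterates_closed:
  assumes "quandle_hom A rhd A rhd \<delta>" and "a \<in> A"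
  shows "(\<delta> ^^ n) a \<in> A"
  using assms by (induction n) (auto simp: quandle_hom_def)

lemma iterates_thompson_rels:
  assumes \<delta>: "quandle_hom A rhd A rhd \<delta>" and a: "a \<in> A"
    and sq: "\<And>q. q \<in> A \<Longrightarrow> \<delta> (\<delta> q) = rhd a (\<delta> q)"
    and "j < k"
  shows "rhd ((\<delta> ^^ j) a) ((\<delta> ^^ k) a) = (\<delta> ^^ Suc k) a"
  using \<open>j < k\<close>
proof (induction j arbitrary: k)
  case 0
  \<comment> \<open>Since \<open>k > 0\<close>, the \<open>k\<close>-th iterate lies in the image of \<open>\<delta>\<close>, where \<open>sq\<close> computes
    left multiplication by \<open>a\<close>.\<close>
  then obtain i where "k = Suc i" by (cases k) auto
  then show ?case
    using sq[OF iterates_closed[OF \<delta> a, of i]] by simp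
next
  case (Suc j)
  then obtain i where k: "k = Suc i" "j < i" by (cases k) auto
  have "rhd ((\<delta> ^^ Suc j) a) ((\<delta> ^^ k) a) = \<delta> (rhd ((\<delta> ^^ j) a) ((\<delta> ^^ i) a))"
    using \<delta> iterates_closed[OF \<delta> a] by (simp add: k quandle_hom_def)
  also have "\<dots> = (\<delta> ^^ Suc k) a"
    using Suc.IH[OF k(2)] by (simp add: k)
  finally show ?case .
qed

theorem proposition2p2:
  fixes Q :: "'q set" and rhd :: "'q \<Rightarrow> 'q \<Rightarrow> 'q"
    and \<delta> :: "'q \<Rightarrow> 'q" and q0 :: 'q
  assumes "quandle Q rhd"
    and "quandle_hom Q rhd Q rhd \<delta>"
    and "q0 \<in> Q"
    and "\<And>q. q \<in> Q \<Longrightarrow> \<delta> (\<delta> q) = rhd q0 (\<delta> q)"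
  shows "\<exists>!f :: thompson \<Rightarrow> 'q.
    quandle_hom UNIV thompson_op Q rhd f \<and> f (thompson_gen 0) = q0 \<and>
    \<delta> \<circ> f = f \<circ> thompson_eps"
proof -
  have "\<exists>f. quandle_hom UNIV thompson_op Q rhd f \<and> (\<forall>n. f (thompson_gen n) = (\<delta> ^^ n) q0)"
  proof (rule thompson_hom_exists[OF assms(1)])
    show "(\<delta> ^^ n) q0 \<in> Q" for n
      by (rule iterates_closed[OF assms(2,3)])
    show "rhd ((\<delta> ^^ j) q0) ((\<delta> ^^ k) q0) = (\<delta> ^^ Suc k) q0" if "j < k" for j k
      by (rule iterates_thompson_rels[OF assms(2-4) that])
  qed
  then obtain f where f: "quandle_hom UNIV thompson_op Q rhd f"
    and f_gen: "\<And>n. f (thompson_gen n) = (\<delta> ^^ n) q0"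
    by blast
  have f_comm: "\<delta> \<circ> f = f \<circ> thompson_eps"
    by (rule thompson_hom_eqI[OF assms(1) quandle_hom_comp[OF f assms(2)]
          quandle_hom_comp[OF thompson_eps_hom f]])
      (simp add: f_gen thompson_eps_gen)
  have unique: "h = f"
    if h: "quandle_hom UNIV thompson_op Q rhd h" and h0: "h (thompson_gen 0) = q0"
      and comm: "\<delta> \<circ> h = h \<circ> thompson_eps" for h
  proof (rule thompson_hom_eqI[OF assms(1) h f])
    have "h (thompson_gen n) = (\<delta> ^^ n) q0" for n
    proof (induction n)
      case (Suc n)
      have "h (thompson_gen (Suc n)) = \<delta> (h (thompson_gen n))"
        using fun_cong[OF comm, of "thompson_gen n"] by (simp add: thompson_eps_gen)
      then show ?case by (simp add: Suc)
    qed (simp add: h0)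
    then show "h (thompson_gen n) = f (thompson_gen n)" for n
      by (simp add: f_gen)
  qed
  show ?thesis
  proof (rule ex1I)
    show "quandle_hom UNIV thompson_op Q rhd f \<and> f (thompson_gen 0) = q0 \<and>
      \<delta> \<circ> f = f \<circ> thompson_eps"
      using f f_gen[of 0] f_comm by simp
  qed (use unique in blast)
qed

end
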